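(* If, for some loopless digraph $\mathbf H$, the problem $\mathrm{PCSP}(\mathbf H,\mathbf G)$ is NP-hard for all loopless digraphs $\mathbf G$ such that $\mathbf H\to\mathbf G$, then $\mathrm{PCSP}(\mathbf K_3,\mathbf G)$ is NP-hard for all loopless digraphs $\mathbf G$ such that $\mathbf K_3\to\mathbf G$.
   Context: Digraphs are finite. $\mathbf K_3$ is the complete loopless graph on 3 vertices, viewed as the digraph with all 6 arcs between distinct vertices. A homomorphism $\mathbf H\to\mathbf G$ is a map $V(H)\to V(G)$ sending arcs to arcs. For digraphs $\mathbf H\to\mathbf G$, $\mathrm{PCSP}(\mathbf H,\mathbf G)$ is the promise decision problem: given a finite digraph $\mathbf I$ with either $\mathbf I\to\mathbf H$ or $\mathbf I\not\to\mathbf G$, output YES in the former case and NO in the latter. *)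

theory Defs
  imports "Graph_Theory.Pair_Digraph" "HOL-Computational_Algebra.Polynomial"
begin

section \<open>Digraphs and homomorphisms\<close>

text \<open>
  Finite digraphs (loops allowed) are captured by \<^locale>\<open>pair_fin_digraph\<close>, finite loopless
  digraphs by \<^locale>\<open>pair_digraph\<close>.
\<close>

definition is_hom :: "('a \<Rightarrow> 'b) \<Rightarrow> 'a pair_pre_digraph \<Rightarrow> 'b pair_pre_digraph \<Rightarrow> bool" where
  "is_hom h H G \<longleftrightarrow>
     (\<forall>v \<in> pverts H. h v \<in> pverts G) \<and> (\<forall>(u, v) \<in> parcs H. (h u, h v) \<in> parcs G)"

definition hom_to :: "'a pair_pre_digraph \<Rightarrow> 'b pair_pre_digraph \<Rightarrow> bool" (infix \<open>\<rightarrow>\<^sub>h\<close> 50) where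
  "H \<rightarrow>\<^sub>h G \<longleftrightarrow> (\<exists>h. is_hom h H G)"

definition K3 :: "nat pair_pre_digraph" where
  "K3 = \<lparr> pverts = {..<3}, parcs = {(u, v). u < 3 \<and> v < 3 \<and> u \<noteq> v} \<rparr>"


section \<open>Turing machines\<close>

text \<open>
  Deterministic machines with finitely many two-way infinite tapes over the alphabet
  consisting of the two bits and the blank symbol \<^const>\<open>None\<close>. A tape is represented relative
  to the head: cell \<open>0\<close> is the scanned cell.
\<close>

type_synonym sym = "bool option"
type_synonym tape = "int \<Rightarrow> sym"

datatype dir = Left | Stay | Right

fun offset :: "dir \<Rightarrow> int" where
  "offset Left = -1"
| "offset Stay = 0"
| "offset Right = 1"

definition act :: "sym \<times> dir \<Rightarrow> tape \<Rightarrow> tape" where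
  "act a T = (\<lambda>i. (T(0 := fst a)) (i + offset (snd a)))"

text \<open>
  The states are \<open>0, \<dots>, nstates M\<close>; state \<open>0\<close> is initial and \<open>nstates M\<close> is the halting state.
\<close>

record tm =
  ntapes :: nat
  nstates :: nat
  delta :: "nat \<Rightarrow> sym list \<Rightarrow> nat \<times> (sym \<times> dir) list"

definition is_tm :: "tm \<Rightarrow> bool" where
  "is_tm M \<longleftrightarrow> ntapes M \<ge> 1 \<and>
     (\<forall>q < nstates M. \<forall>rs. length rs = ntapes M \<longrightarrow>
        fst (delta M q rs) \<le> nstates M \<and> length (snd (delta M q rs)) = ntapes M)"

type_synonym config = "nat \<times> (nat \<Rightarrow> tape)"

definition step :: "tm \<Rightarrow> config \<Rightarrow> config" where
  "step M = (\<lambda>(q, Ts).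
     if q < nstates M then
       (let (q', as) = delta M q (map (\<lambda>i. Ts i 0) [0..<ntapes M])
        in (q', \<lambda>i. if i < ntapes M then act (as ! i) (Ts i) else Ts i))
     else (q, Ts))"

definition tape_of :: "bool list \<Rightarrow> tape" where
  "tape_of w = (\<lambda>i. if 0 \<le> i \<and> i < int (length w) then Some (w ! nat i) else None)"

definition init :: "bool list list \<Rightarrow> config" where
  "init ws = (0, \<lambda>i. if i < length ws then tape_of (ws ! i) else tape_of [])"

text \<open>
  Started with the words \<open>ws\<close> on its first tapes, \<open>M\<close> halts within \<open>t\<close> steps with output \<open>y\<close> on
  tape \<open>0\<close>. A halted configuration is a fixed point of \<^const>\<open>step\<close>.
\<close>

definition outputs_within :: "tm \<Rightarrow> bool list list \<Rightarrow> nat \<Rightarrow> bool list \<Rightarrow> bool" where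
  "outputs_within M ws t y \<longleftrightarrow>
     length ws \<le> ntapes M \<and>
     (\<exists>Ts. (step M ^^ t) (init ws) = (nstates M, Ts) \<and> Ts 0 = tape_of y)"


section \<open>Polynomial time and NP-hardness\<close>

definition polytime_computable :: "(bool list \<Rightarrow> bool list) \<Rightarrow> bool" where
  "polytime_computable f \<longleftrightarrow>
     (\<exists>M (p :: nat poly). is_tm M \<and>
        (\<forall>x. outputs_within M [x] (poly p (length x)) (f x)))"

definition polytime_decidable2 :: "(bool list \<Rightarrow> bool list \<Rightarrow> bool) \<Rightarrow> bool" where
  "polytime_decidable2 V \<longleftrightarrow>
     (\<exists>M (p :: nat poly). is_tm M \<and>
        (\<forall>x y. outputs_within M [x, y] (poly p (length x + length y)) [V x y]))"

definition in_NP :: "bool list set \<Rightarrow> bool" where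
  "in_NP L \<longleftrightarrow>
     (\<exists>V (q :: nat poly). polytime_decidable2 V \<and>
        (\<forall>x. x \<in> L \<longleftrightarrow> (\<exists>y. length y \<le> poly q (length x) \<and> V x y)))"

text \<open>
  A promise problem is the pair of its YES-instances and its NO-instances. Hardness is with respect
  to polynomial-time many-one reductions.
\<close>

type_synonym promise_problem = "bool list set \<times> bool list set"

definition reduces_to :: "bool list set \<Rightarrow> promise_problem \<Rightarrow> bool" where
  "reduces_to L P \<longleftrightarrow>
     (\<exists>f. polytime_computable f \<and>
        (\<forall>x. (x \<in> L \<longrightarrow> f x \<in> fst P) \<and> (x \<notin> L \<longrightarrow> f x \<in> snd P)))"

definition NP_hard :: "promise_problem \<Rightarrow> bool" where
  "NP_hard P \<longleftrightarrow> (\<forall>L. in_NP L \<longrightarrow> reduces_to L P)"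


section \<open>Promise constraint satisfaction problems\<close>

definition instance_digraph :: "nat pair_pre_digraph \<Rightarrow> bool" where
  "instance_digraph I \<longleftrightarrow> pair_fin_digraph I \<and> pverts I = {..<card (pverts I)}"

text \<open>The number of vertices in unary, a separator, and the adjacency matrix row by row.\<close>

definition encode :: "nat pair_pre_digraph \<Rightarrow> bool list" where
  "encode I = (let n = card (pverts I) in
     replicate n True @ [False] @ [(u, v) \<in> parcs I. u \<leftarrow> [0..<n], v \<leftarrow> [0..<n]])"

definition PCSP :: "'a pair_pre_digraph \<Rightarrow> 'b pair_pre_digraph \<Rightarrow> promise_problem" where
  "PCSP H G =
     ({encode I | I. instance_digraph I \<and> I \<rightarrow>\<^sub>h H},
      {encode I | I. instance_digraph I \<and> \<not> I \<rightarrow>\<^sub>h G})"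

end

theory Submission
  imports Defs
begin

text \<open>
  Let \<open>D\<close> denote the arc digraph construction: the vertices of \<open>D I\<close> are the arcs of \<open>I\<close>, and there
  is an arc from \<open>(u, v)\<close> to \<open>(v, w)\<close>. If \<open>I\<close> has a proper colouring with \<open>k + 1 \<ge> 4\<close> colours then
  \<open>D (D I)\<close> has one with \<open>k\<close> colours; hence \<open>D ^ (2 * m)\<close> maps all digraphs that admit a
  homomorphism to \<open>H\<close>, with \<open>m\<close> the number of vertices of \<open>H\<close>, to 3-colourable ones. Conversely, if
  \<open>D I\<close> is \<open>k\<close>-colourable then \<open>I\<close> is \<open>2 ^ k\<close>-colourable. So if \<open>D ^ (2 * m) I\<close> maps to the loopless
  digraph \<open>G\<close>, then \<open>I\<close> maps to a complete digraph \<open>G'\<close> depending only on \<open>G\<close> and \<open>m\<close>, and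
  \<open>D ^ (2 * m)\<close> reduces \<open>PCSP(H, G')\<close> to \<open>PCSP(K3, G)\<close>. That \<open>D\<close> is computable in polynomial time
  is shown with an explicit seven-tape machine, compiled from a structured program.
\<close>

section \<open>Homomorphisms into complete digraphs\<close>

definition complete_on :: "'a set \<Rightarrow> 'a pair_pre_digraph" where
  "complete_on C = \<lparr> pverts = C, parcs = {(u, v). u \<in> C \<and> v \<in> C \<and> u \<noteq> v} \<rparr>"

lemma hom_toI: "is_hom h G H \<Longrightarrow> G \<rightarrow>\<^sub>h H"
  by (auto simp: hom_to_def)

lemma is_hom_comp: "is_hom f F G \<Longrightarrow> is_hom g G H \<Longrightarrow> is_hom (g \<circ> f) F H"
  by (fastforce simp: is_hom_def)

lemma hom_to_trans [trans]: "F \<rightarrow>\<^sub>h G \<Longrightarrow> G \<rightarrow>\<^sub>h H \<Longrightarrow> F \<rightarrow>\<^sub>h H"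
  unfolding hom_to_def using is_hom_comp by blast

lemma K3_eq_complete_on: "K3 = complete_on {..<3}"
  by (simp add: K3_def complete_on_def)

lemma pair_digraph_complete_on:
  assumes "finite C"
  shows "pair_digraph (complete_on C)"
proof -
  have "parcs (complete_on C) \<subseteq> C \<times> C"
    by (auto simp: complete_on_def)
  with assms have "finite (parcs (complete_on C))"
    using finite_subset by blast
  with assms show ?thesis
    by unfold_locales (auto simp: complete_on_def)
qed

lemma is_hom_complete_onI:
  assumes "\<And>v. v \<in> pverts G \<Longrightarrow> c v \<in> C"
    and "\<And>u v. (u, v) \<in> parcs G \<Longrightarrow> c u \<in> C \<and> c v \<in> C \<and> c u \<noteq> c v"
  shows "is_hom c G (complete_on C)"
  using assms by (auto simp: is_hom_def complete_on_def)

lemma is_hom_complete_onD: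
  assumes "is_hom c G (complete_on C)"
  shows "v \<in> pverts G \<Longrightarrow> c v \<in> C"
    and "(u, v) \<in> parcs G \<Longrightarrow> c u \<in> C" and "(u, v) \<in> parcs G \<Longrightarrow> c v \<in> C"
    and "(u, v) \<in> parcs G \<Longrightarrow> c u \<noteq> c v"
  using assms by (auto simp: is_hom_def complete_on_def)

lemma complete_on_hom_to_if_card_le:
  assumes "finite C" "finite D" "card C \<le> card D"
  shows "complete_on C \<rightarrow>\<^sub>h complete_on D"
proof -
  obtain f where "f ` C \<subseteq> D" "inj_on f C"
    using card_le_inj[OF assms] by blast
  then have "is_hom f (complete_on C) (complete_on D)"
    by (intro is_hom_complete_onI) (auto simp: complete_on_def dest: inj_onD)
  then show ?thesis
    by (rule hom_toI)
qed

lemma pair_digraph_hom_to_complete_on: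
  assumes "pair_digraph G" "card (pverts G) \<le> k"
  shows "G \<rightarrow>\<^sub>h complete_on {..<k}"
proof -
  interpret pair_digraph G by fact
  have "is_hom id G (complete_on (pverts G))"
    using no_loops' in_arcsD1 in_arcsD2 by (intro is_hom_complete_onI) auto
  then have "G \<rightarrow>\<^sub>h complete_on (pverts G)"
    by (rule hom_toI)
  also have "\<dots> \<rightarrow>\<^sub>h complete_on {..<k}"
    using assms(2) by (intro complete_on_hom_to_if_card_le) simp_all
  finally show ?thesis .
qed

section \<open>Arc digraphs\<close>

definition arc_digraph :: "'a pair_pre_digraph \<Rightarrow> ('a \<times> 'a) pair_pre_digraph" where
  "arc_digraph G = \<lparr> pverts = parcs G,
     parcs = {((u, v), (v, w)) | u v w. (u, v) \<in> parcs G \<and> (v, w) \<in> parcs G} \<rparr>"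

lemma arc_digraph_hom_to_arc_digraph:
  assumes "\<And>u v. (u, v) \<in> parcs G \<Longrightarrow> (h u, h v) \<in> parcs H"
  shows "arc_digraph G \<rightarrow>\<^sub>h arc_digraph H"
proof (rule hom_toI)
  show "is_hom (map_prod h h) (arc_digraph G) (arc_digraph H)"
    using assms by (fastforce simp: is_hom_def arc_digraph_def)
qed

text \<open>A vertex is coloured with the set of colours of its outgoing arcs.\<close>

lemma hom_to_complete_on_Pow_if_arc_digraph:
  assumes "arc_digraph G \<rightarrow>\<^sub>h complete_on C"
  shows "G \<rightarrow>\<^sub>h complete_on (Pow C)"
proof -
  obtain c where c: "is_hom c (arc_digraph G) (complete_on C)"
    using assms by (auto simp: hom_to_def)
  define S where "S u = {c (u, v) | v. (u, v) \<in> parcs G}" for u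
  have "S u \<in> Pow C" for u
    using is_hom_complete_onD(1)[OF c] by (auto simp: S_def arc_digraph_def)
  moreover have "S u \<noteq> S v" if uv: "(u, v) \<in> parcs G" for u v
  proof
    assume "S u = S v"
    moreover have "c (u, v) \<in> S u"
      using uv by (auto simp: S_def)
    ultimately obtain w where w: "(v, w) \<in> parcs G" "c (u, v) = c (v, w)"
      by (auto simp: S_def)
    have "((u, v), (v, w)) \<in> parcs (arc_digraph G)"
      using uv w(1) by (simp add: arc_digraph_def)
    with w(2) show False
      using is_hom_complete_onD(4)[OF c] by blast
  qed
  ultimately have "is_hom S G (complete_on (Pow C))"
    by (intro is_hom_complete_onI) auto
  then show ?thesis
    by (rule hom_toI)
qed

text \<open>
  A walk \<open>x, y, z\<close> inherits the colour of \<open>y\<close>, except that the surplus colour \<open>a\<close> is replaced by one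
  different from those of \<open>x\<close> and \<open>z\<close>; this is where three colours are needed.
\<close>

lemma arc_digraph_arc_digraph_hom_to_complete_on:
  fixes G :: "'a pair_pre_digraph" and C :: "'b set"
  assumes "G \<rightarrow>\<^sub>h complete_on (insert a C)" "3 \<le> card C"
  shows "arc_digraph (arc_digraph G) \<rightarrow>\<^sub>h complete_on C"
proof -
  obtain c where c: "is_hom c G (complete_on (insert a C))"
    using assms(1) by (auto simp: hom_to_def)
  have arcD: "c x \<noteq> c y" "c x \<notin> C \<Longrightarrow> c x = a" "c y \<notin> C \<Longrightarrow> c y = a" if "(x, y) \<in> parcs G" for x y
    using is_hom_complete_onD[OF c] that by blast+
  have "\<exists>s. s \<in> C \<and> s \<noteq> c x \<and> s \<noteq> c z" for x z
  proof -
    have "card {c x, c z} \<le> 2"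
      by (simp add: card_insert_if)
    with assms(2) have "\<not> C \<subseteq> {c x, c z}"
      using card_mono[of "{c x, c z}" C] by auto
    then show ?thesis
      by blast
  qed
  then obtain spare where
    spare: "\<And>x z. spare x z \<in> C" "\<And>x z. spare x z \<noteq> c x" "\<And>x z. spare x z \<noteq> c z"
    by metis
  define walk_colour :: "('a \<times> 'a) \<times> 'a \<times> 'a \<Rightarrow> 'b" where
    "walk_colour = (\<lambda>((x, y), (_, z)). if c y \<in> C then c y else spare x z)"
  have "walk_colour P \<in> C" for P
    using spare(1) by (simp add: walk_colour_def split: prod.split)
  moreover have "walk_colour P \<noteq> walk_colour Q"
    if arc: "(P, Q) \<in> parcs (arc_digraph (arc_digraph G))" for P Q
  proof -
    obtain w x y z where "P = ((w, x), (x, y))" "Q = ((x, y), (y, z))" "(x, y) \<in> parcs G"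
      using arc by (auto simp: arc_digraph_def)
    with arcD[of x y] spare(2)[of x z] spare(3)[of w y] show ?thesis
      by (simp add: walk_colour_def split: if_split) metis
  qed
  ultimately have "is_hom walk_colour (arc_digraph (arc_digraph G)) (complete_on C)"
    by (intro is_hom_complete_onI) auto
  then show ?thesis
    by (rule hom_toI)
qed

section \<open>Arc digraphs of instances\<close>

text \<open>
  The pair \<open>(u, v)\<close> of vertices of a digraph on \<open>{..<n}\<close> is coded by the number \<open>u * n + v\<close>.
  Pairs that are not arcs are kept as isolated vertices, which do not matter for homomorphisms into
  a digraph with at least one vertex.
\<close>

definition arc_instance :: "nat pair_pre_digraph \<Rightarrow> nat pair_pre_digraph" where
  "arc_instance I = (let n = card (pverts I) in
     \<lparr> pverts = {..<n * n},
       parcs = {(p, q). p < n * n \<and> q < n * n \<and>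
         ((p div n, p mod n), (q div n, q mod n)) \<in> parcs (arc_digraph I)} \<rparr>)"

lemma pverts_arc_instance: "pverts (arc_instance I) = {..<card (pverts I) * card (pverts I)}"
  by (simp add: arc_instance_def Let_def)

lemma instance_digraph_arc_instance: "instance_digraph (arc_instance I)"
proof -
  have arcs: "parcs (arc_instance I) \<subseteq> pverts (arc_instance I) \<times> pverts (arc_instance I)"
    by (auto simp: arc_instance_def Let_def)
  then have "finite (parcs (arc_instance I))"
    by (rule finite_subset) (simp add: pverts_arc_instance)
  with arcs have "pair_fin_digraph (arc_instance I)"
    by unfold_locales (auto simp: pverts_arc_instance)
  then show ?thesis
    by (simp add: instance_digraph_def pverts_arc_instance)
qed

lemma instance_digraph_arc_instance_funpow:
  "instance_digraph I \<Longrightarrow> instance_digraph ((arc_instance ^^ i) I)"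
  by (cases i) (auto simp: instance_digraph_arc_instance)

lemma arc_digraph_hom_to_arc_instance:
  assumes "instance_digraph I"
  shows "arc_digraph I \<rightarrow>\<^sub>h arc_instance I"
proof -
  interpret pair_fin_digraph I
    using assms by (simp add: instance_digraph_def)
  define n where "n = card (pverts I)"
  have arc_less: "u < n" "v < n" if "(u, v) \<in> parcs I" for u v
    using assms in_arcsD1[OF that] in_arcsD2[OF that] by (auto simp: instance_digraph_def n_def)
  have code_less: "u * n + v < n * n" if "(u, v) \<in> parcs I" for u v
  proof -
    have "u * n + v < Suc u * n" using arc_less[OF that] by simp
    also have "\<dots> \<le> n * n" using arc_less[OF that] by (intro mult_le_mono) auto
    finally show ?thesis .
  qed
  have "(u * n + v) div n = u" "(u * n + v) mod n = v" if "(u, v) \<in> parcs I" for u v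
    using arc_less[OF that] by simp_all
  with code_less have "is_hom (\<lambda>(u, v). u * n + v) (arc_digraph I) (arc_instance I)"
    by (auto simp: is_hom_def arc_digraph_def arc_instance_def Let_def simp flip: n_def)
  then show ?thesis
    by (rule hom_toI)
qed

lemma arc_instance_hom_to_if_arc_digraph:
  assumes "arc_digraph I \<rightarrow>\<^sub>h G" "pverts G \<noteq> {}"
  shows "arc_instance I \<rightarrow>\<^sub>h G"
proof -
  obtain h where h: "is_hom h (arc_digraph I) G"
    using assms(1) by (auto simp: hom_to_def)
  obtain g where g: "g \<in> pverts G"
    using assms(2) by blast
  define n where "n = card (pverts I)"
  define decode where "decode p = (p div n, p mod n)" for p
  have "is_hom (\<lambda>p. if decode p \<in> parcs I then h (decode p) else g) (arc_instance I) G"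
    using h g
    by (auto simp: is_hom_def arc_instance_def arc_digraph_def Let_def decode_def simp flip: n_def)
  then show ?thesis
    by (rule hom_toI)
qed

lemma arc_digraph_arc_instance_hom_to:
  "arc_digraph (arc_instance I) \<rightarrow>\<^sub>h arc_digraph (arc_digraph I)"
proof (rule arc_digraph_hom_to_arc_digraph)
  define n where "n = card (pverts I)"
  show "((p div n, p mod n), (q div n, q mod n)) \<in> parcs (arc_digraph I)"
    if "(p, q) \<in> parcs (arc_instance I)" for p q
    using that by (simp add: arc_instance_def Let_def n_def)
qed

lemma arc_instance_arc_instance_hom_to_complete_on:
  assumes "I \<rightarrow>\<^sub>h complete_on {..<Suc k}" "3 \<le> k"
  shows "arc_instance (arc_instance I) \<rightarrow>\<^sub>h complete_on {..<k}"
proof (rule arc_instance_hom_to_if_arc_digraph)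
  have "arc_digraph (arc_instance I) \<rightarrow>\<^sub>h arc_digraph (arc_digraph I)"
    by (rule arc_digraph_arc_instance_hom_to)
  also have "\<dots> \<rightarrow>\<^sub>h complete_on {..<k}"
    using assms by (intro arc_digraph_arc_digraph_hom_to_complete_on) (simp_all add: lessThan_Suc)
  finally show "arc_digraph (arc_instance I) \<rightarrow>\<^sub>h complete_on {..<k}" .
  show "pverts (complete_on {..<k}) \<noteq> {}"
    using assms(2) by (simp add: complete_on_def lessThan_empty_iff)
qed

lemma arc_instance_funpow_hom_to_complete_on:
  assumes "I \<rightarrow>\<^sub>h complete_on {..<k + m}" "3 \<le> k"
  shows "(arc_instance ^^ (2 * m)) I \<rightarrow>\<^sub>h complete_on {..<k}"
  using assms(1)
proof (induction m arbitrary: I)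
  case (Suc m)
  have "arc_instance (arc_instance I) \<rightarrow>\<^sub>h complete_on {..<k + m}"
    using Suc.prems assms(2) by (intro arc_instance_arc_instance_hom_to_complete_on) auto
  from Suc.IH[OF this] show ?case
    by (simp add: funpow_swap1)
qed simp

lemma hom_to_complete_on_if_arc_instance:
  fixes k :: nat
  assumes "instance_digraph I" "arc_instance I \<rightarrow>\<^sub>h complete_on {..<k}"
  shows "I \<rightarrow>\<^sub>h complete_on {..<2 ^ k :: nat}"
proof -
  have "arc_digraph I \<rightarrow>\<^sub>h complete_on {..<k}"
    using arc_digraph_hom_to_arc_instance[OF assms(1)] assms(2) by (rule hom_to_trans)
  then have "I \<rightarrow>\<^sub>h complete_on (Pow {..<k})"
    by (rule hom_to_complete_on_Pow_if_arc_digraph)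
  also have "\<dots> \<rightarrow>\<^sub>h complete_on {..<2 ^ k :: nat}"
    by (intro complete_on_hom_to_if_card_le) (simp_all add: card_Pow)
  finally show ?thesis .
qed

lemma hom_to_complete_on_if_arc_instance_funpow:
  fixes k :: nat
  assumes "instance_digraph I" "(arc_instance ^^ i) I \<rightarrow>\<^sub>h complete_on {..<k}"
  shows "I \<rightarrow>\<^sub>h complete_on {..<((^) 2 ^^ i) k :: nat}"
  using assms(2)
proof (induction i arbitrary: k)
  case (Suc i)
  have "(arc_instance ^^ i) I \<rightarrow>\<^sub>h complete_on {..<2 ^ k :: nat}"
    using Suc.prems instance_digraph_arc_instance_funpow[OF assms(1)]
    by (intro hom_to_complete_on_if_arc_instance) simp_all
  from Suc.IH[OF this] show ?case
    by (simp add: funpow_swap1)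
qed simp

lemma arc_instance_funpow_hom_to_K3:
  assumes "pair_digraph H" "I \<rightarrow>\<^sub>h H"
  shows "(arc_instance ^^ (2 * card (pverts H))) I \<rightarrow>\<^sub>h K3"
proof -
  note assms(2)
  also have "H \<rightarrow>\<^sub>h complete_on {..<3 + card (pverts H)}"
    using assms(1) by (rule pair_digraph_hom_to_complete_on) simp
  finally show ?thesis
    unfolding K3_eq_complete_on by (rule arc_instance_funpow_hom_to_complete_on) simp
qed

lemma hom_to_complete_on_if_arc_instance_funpow_hom_to:
  fixes k :: nat
  assumes "pair_digraph G" "instance_digraph I" "(arc_instance ^^ i) I \<rightarrow>\<^sub>h G"
    and "((^) 2 ^^ i) (card (pverts G)) \<le> k"
  shows "I \<rightarrow>\<^sub>h complete_on {..<k}"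
proof -
  have "(arc_instance ^^ i) I \<rightarrow>\<^sub>h complete_on {..<card (pverts G)}"
    using assms(3) pair_digraph_hom_to_complete_on[OF assms(1) order_refl] by (rule hom_to_trans)
  with assms(2) have "I \<rightarrow>\<^sub>h complete_on {..<((^) 2 ^^ i) (card (pverts G)) :: nat}"
    by (rule hom_to_complete_on_if_arc_instance_funpow)
  also have "\<dots> \<rightarrow>\<^sub>h complete_on {..<k}"
    using assms(4) by (intro complete_on_hom_to_if_card_le) simp_all
  finally show ?thesis .
qed

section \<open>Bounded reachability of configurations\<close>

definition reaches :: "tm \<Rightarrow> nat \<Rightarrow> config \<Rightarrow> config \<Rightarrow> bool" where
  "reaches M t c d \<longleftrightarrow> (\<exists>s\<le>t. (step M ^^ s) c = d)"

lemma reaches_refl: "reaches M t c c"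
  unfolding reaches_def by (intro exI[of _ 0]) simp

lemma reaches_step: "step M c = d \<Longrightarrow> reaches M 1 c d"
  unfolding reaches_def by (intro exI[of _ 1]) simp

lemma reaches_mono: "reaches M s c d \<Longrightarrow> s \<le> t \<Longrightarrow> reaches M t c d"
  unfolding reaches_def using le_trans by blast

lemma reaches_trans [trans]:
  assumes "reaches M s c d" "reaches M t d e"
  shows "reaches M (s + t) c e"
proof -
  obtain s' t' where "s' \<le> s" "(step M ^^ s') c = d" "t' \<le> t" "(step M ^^ t') d = e"
    using assms by (auto simp: reaches_def)
  then have "t' + s' \<le> s + t" "(step M ^^ (t' + s')) c = e"
    by (simp_all add: funpow_add)
  then show ?thesis
    unfolding reaches_def by blast
qed

lemma step_running:
  fixes Ts :: "nat \<Rightarrow> tape"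
  assumes "q < nstates M"
  defines "rs \<equiv> map (\<lambda>i. Ts i 0) [0..<ntapes M]"
  shows "step M (q, Ts) = (fst (delta M q rs),
    \<lambda>i. if i < ntapes M then act (snd (delta M q rs) ! i) (Ts i) else Ts i)"
  unfolding rs_def using assms(1) by (simp add: step_def Let_def case_prod_beta)

lemma step_halted: "step M (nstates M, Ts) = (nstates M, Ts)"
  by (simp add: step_def)

lemma outputs_within_iff_reaches:
  "outputs_within M ws t y \<longleftrightarrow>
     length ws \<le> ntapes M \<and> (\<exists>Ts. reaches M t (init ws) (nstates M, Ts) \<and> Ts 0 = tape_of y)"
proof -
  have "(step M ^^ t) c = (nstates M, Ts) \<longleftrightarrow> reaches M t c (nstates M, Ts)" for c Ts
  proof
    assume "reaches M t c (nstates M, Ts)"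
    then obtain s r where "t = r + s" "(step M ^^ s) c = (nstates M, Ts)"
      by (metis le_add_diff_inverse2 reaches_def)
    moreover have "(step M ^^ r) (nstates M, Ts) = (nstates M, Ts)" for r
      by (induction r) (simp_all add: step_halted)
    ultimately show "(step M ^^ t) c = (nstates M, Ts)"
      by (simp add: funpow_add)
  qed (auto simp: reaches_def)
  then show ?thesis
    by (simp add: outputs_within_def)
qed

lemma outputs_within_mono:
  "outputs_within M ws s y \<Longrightarrow> s \<le> t \<Longrightarrow> outputs_within M ws t y"
  unfolding outputs_within_iff_reaches using reaches_mono by blast

lemma reaches_simulation:
  assumes "reaches M t c d" "R c c'"
    and step: "\<And>c c'. R c c' \<Longrightarrow> \<exists>d'. reaches N 1 c' d' \<and> R (step M c) d'"
  shows "\<exists>d'. reaches N t c' d' \<and> R d d'"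
proof -
  have "\<exists>d'. reaches N s c' d' \<and> R ((step M ^^ s) c) d'" for s
  proof (induction s)
    case 0
    then show ?case
      using assms(2) reaches_refl by (metis funpow_0)
  next
    case (Suc s)
    then obtain d' where "reaches N s c' d'" "R ((step M ^^ s) c) d'"
      by blast
    with step[of "(step M ^^ s) c" d'] show ?case
      using reaches_trans[of N s c' d' 1] by auto
  qed
  then show ?thesis
    using assms(1) reaches_mono unfolding reaches_def[of M] by metis
qed

section \<open>Length of outputs\<close>

definition blank_above :: "int \<Rightarrow> tape \<Rightarrow> bool" where
  "blank_above b T \<longleftrightarrow> (\<forall>i>b. T i = None)"

lemma blank_above_act: "blank_above b T \<Longrightarrow> 0 \<le> b \<Longrightarrow> blank_above (b + 1) (act a T)"
  by (cases "snd a") (auto simp: blank_above_def act_def)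

lemma blank_above_step:
  assumes "blank_above b (snd c j)" "0 \<le> b"
  shows "blank_above (b + 1) (snd (step M c) j)"
proof -
  have "blank_above (b + 1) (snd c j)"
    using assms(1) by (simp add: blank_above_def)
  with blank_above_act[OF assms] show ?thesis
    by (simp add: step_def Let_def case_prod_beta)
qed

lemma blank_above_steps:
  assumes "blank_above (int b) (snd c j)"
  shows "blank_above (int (b + t)) (snd ((step M ^^ t) c) j)"
proof (induction t)
  case (Suc t)
  from blank_above_step[OF Suc, of M] show ?case
    by (simp add: add.commute)
qed (use assms in simp)

lemma length_le_if_blank_above: "blank_above (int b) (tape_of y) \<Longrightarrow> length y \<le> Suc b"
  by (rule ccontr) (auto simp: blank_above_def tape_of_def dest!: spec[of _ "int b + 1"])

lemma length_output_le:
  assumes "outputs_within M [x] t y"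
  shows "length y \<le> Suc (length x + t)"
proof -
  obtain Ts where Ts: "(step M ^^ t) (init [x]) = (nstates M, Ts)" "Ts 0 = tape_of y"
    using assms by (auto simp: outputs_within_def)
  have "blank_above (int (length x)) (snd (init [x]) 0)"
    by (simp add: blank_above_def init_def tape_of_def)
  from blank_above_steps[OF this, of t M] Ts show ?thesis
    by (intro length_le_if_blank_above) simp
qed

section \<open>Sequential composition of Turing machines\<close>

text \<open>
  The second machine works on tape \<open>0\<close>, which holds the output of the first one, and otherwise on
  fresh tapes. The halting state of the first machine is the initial state of the second one.
\<close>

definition comp_tape :: "tm \<Rightarrow> nat \<Rightarrow> nat" where
  "comp_tape M j = (if j = 0 then 0 else ntapes M + j)"

definition comp_tm :: "tm \<Rightarrow> tm \<Rightarrow> tm" where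
  "comp_tm M N = \<lparr> ntapes = ntapes M + ntapes N, nstates = nstates M + nstates N,
     delta = (\<lambda>q rs.
       if q < nstates M then
         (let (q', as) = delta M q (take (ntapes M) rs)
          in (q', as @ map (\<lambda>s. (s, Stay)) (drop (ntapes M) rs)))
       else
         (let (q', as) = delta N (q - nstates M) (map (\<lambda>j. rs ! comp_tape M j) [0..<ntapes N])
          in (nstates M + q', map (\<lambda>i. if i = 0 then as ! 0
                else if i \<le> ntapes M then (rs ! i, Stay)
                else as ! (i - ntapes M)) [0..<ntapes M + ntapes N]))) \<rparr>"

lemma ntapes_comp_tm: "ntapes (comp_tm M N) = ntapes M + ntapes N"
  and nstates_comp_tm: "nstates (comp_tm M N) = nstates M + nstates N"
  by (simp_all add: comp_tm_def)

lemma is_tmD: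
  assumes "is_tm M"
  shows "0 < ntapes M"
    and "q < nstates M \<Longrightarrow> length rs = ntapes M \<Longrightarrow> fst (delta M q rs) \<le> nstates M"
    and "q < nstates M \<Longrightarrow> length rs = ntapes M \<Longrightarrow> length (snd (delta M q rs)) = ntapes M"
  using assms by (auto simp: is_tm_def)

lemma is_tm_comp_tm:
  assumes "is_tm M" "is_tm N"
  shows "is_tm (comp_tm M N)"
  unfolding is_tm_def
proof (intro conjI allI impI)
  show "1 \<le> ntapes (comp_tm M N)"
    using is_tmD(1)[OF assms(1)] by (simp add: ntapes_comp_tm)
  fix q and rs :: "sym list"
  assume q: "q < nstates (comp_tm M N)" and rs: "length rs = ntapes (comp_tm M N)"
  let ?rs = "take (ntapes M) rs" and ?rs' = "map (\<lambda>j. rs ! comp_tape M j) [0..<ntapes N]"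
  have first: "fst (delta M q ?rs) \<le> nstates M" "length (snd (delta M q ?rs)) = ntapes M"
    if "q < nstates M"
    using is_tmD(2,3)[OF assms(1) that] rs by (simp_all add: ntapes_comp_tm)
  have second: "fst (delta N (q - nstates M) ?rs') \<le> nstates N" if "\<not> q < nstates M"
    using that q by (intro is_tmD(2)[OF assms(2)]) (auto simp: nstates_comp_tm)
  show "fst (delta (comp_tm M N) q rs) \<le> nstates (comp_tm M N)"
    and "length (snd (delta (comp_tm M N) q rs)) = ntapes (comp_tm M N)"
    using first second rs by (auto simp: comp_tm_def case_prod_beta)
qed

lemma act_scanned_Stay: "act (T 0, Stay) T = T"
  by (auto simp: act_def)

lemma step_comp_tm_first:
  assumes "is_tm M" "q < nstates M"
  shows "step (comp_tm M N) (q, Ts) = step M (q, Ts)"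
proof -
  let ?scan = "\<lambda>is. map (\<lambda>i. Ts i 0) is" and ?m = "ntapes M"
  have tapes: "[0..<?m + ntapes N] = [0..<?m] @ [?m..<?m + ntapes N]"
    by (metis le_add1 le_add_same_cancel1 upt_add_eq_append)
  obtain q' as where delta_M: "delta M q (?scan [0..<?m]) = (q', as)"
    by force
  have delta_comp: "delta (comp_tm M N) q (?scan [0..<?m + ntapes N])
      = (q', as @ map (\<lambda>s. (s, Stay)) (?scan [?m..<?m + ntapes N]))"
    unfolding tapes using assms(2) delta_M by (simp add: comp_tm_def)
  have "length as = ?m"
    using is_tmD(3)[OF assms, of "?scan [0..<?m]"] delta_M by simp
  then show ?thesis
    using assms(2) by (auto simp: step_running ntapes_comp_tm nstates_comp_tm delta_comp delta_M
        nth_append act_scanned_Stay fun_eq_iff simp del: upt_Suc)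
qed

lemma step_comp_tm_second:
  assumes "is_tm M" "is_tm N" "\<And>j. j < ntapes N \<Longrightarrow> Us (comp_tape M j) = Ts j"
    and step: "step N (q, Ts) = (q', Ts')"
  obtains Us' where "step (comp_tm M N) (nstates M + q, Us) = (nstates M + q', Us')"
    "\<And>j. j < ntapes N \<Longrightarrow> Us' (comp_tape M j) = Ts' j"
proof (cases "q < nstates N")
  case False
  then show thesis
    using step assms(3) by (intro that[of Us]) (auto simp: step_def nstates_comp_tm)
next
  case True
  let ?rs = "map (\<lambda>i. Us i 0) [0..<ntapes M + ntapes N]"
  note ntapes_pos = assms(1,2)[THEN is_tmD(1)]
  have tape_less: "comp_tape M j < ntapes M + ntapes N" if "j < ntapes N" for j
    using that ntapes_pos by (auto simp: comp_tape_def)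
  then have scan_eq:
    "map (\<lambda>j. ?rs ! comp_tape M j) [0..<ntapes N] = map (\<lambda>i. Ts i 0) [0..<ntapes N]"
    using assms(3) by simp
  obtain as where delta_N: "delta N q (map (\<lambda>i. Ts i 0) [0..<ntapes N]) = (q', as)"
    and Ts': "Ts' = (\<lambda>i. if i < ntapes N then act (as ! i) (Ts i) else Ts i)"
    using step True by (auto simp: step_running prod_eq_iff)
  let ?Us' = "\<lambda>i. if i < ntapes M + ntapes N then
      act (if i = 0 then as ! 0 else if i \<le> ntapes M then (Us i 0, Stay)
        else as ! (i - ntapes M)) (Us i)
    else Us i"
  have "step (comp_tm M N) (nstates M + q, Us) = (nstates M + q', ?Us')"
    using True by (auto simp: step_running nstates_comp_tm)
      (auto simp: comp_tm_def scan_eq delta_N fun_eq_iff simp del: upt_Suc)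
  moreover have "?Us' (comp_tape M j) = Ts' j" if "j < ntapes N" for j
    using that assms(3)[OF that] tape_less[OF that] by (auto simp: Ts' comp_tape_def)
  ultimately show thesis
    by (rule that)
qed

lemma reaches_comp_tm_first:
  assumes "is_tm M" "reaches M t c (q, Ts)" "\<And>i. ntapes M \<le> i \<Longrightarrow> snd c i = T"
  shows "reaches (comp_tm M N) t c (q, Ts)" and "\<And>i. ntapes M \<le> i \<Longrightarrow> Ts i = T"
proof -
  define R where "R c d \<longleftrightarrow> d = c \<and> (\<forall>i\<ge>ntapes M. snd c i = T)" for c d :: config
  have simulation: "\<exists>e. reaches (comp_tm M N) 1 d e \<and> R (step M c) e" if "R c d" for c d
  proof (cases "fst c < nstates M")
    case True
    have "step (comp_tm M N) c = step M c"
      using step_comp_tm_first[OF assms(1) True] by (metis prod.collapse)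
    moreover have "R (step M c) (step M c)"
      using that True step_running[OF True, of "snd c"] by (auto simp: R_def)
    ultimately show ?thesis
      using that reaches_step by (metis R_def)
  next
    case False
    then have "step M c = c"
      by (simp add: step_def case_prod_beta)
    with that show ?thesis
      using reaches_refl by (metis R_def)
  qed
  have "R c c"
    using assms(3) by (simp add: R_def)
  from reaches_simulation[OF assms(2) this simulation]
  show "reaches (comp_tm M N) t c (q, Ts)" "\<And>i. ntapes M \<le> i \<Longrightarrow> Ts i = T"
    by (auto simp: R_def)
qed

lemma reaches_comp_tm_second:
  assumes "is_tm M" "is_tm N" "reaches N t (q, Ts) (q', Ts')"
    and "\<And>j. j < ntapes N \<Longrightarrow> Us (comp_tape M j) = Ts j"
  obtains Us' where "reaches (comp_tm M N) t (nstates M + q, Us) (nstates M + q', Us')"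
    "\<And>j. j < ntapes N \<Longrightarrow> Us' (comp_tape M j) = Ts' j"
proof -
  define R where "R c d \<longleftrightarrow> fst d = nstates M + fst c \<and>
    (\<forall>j<ntapes N. snd d (comp_tape M j) = snd c j)" for c d :: config
  have simulation: "\<exists>e. reaches (comp_tm M N) 1 d e \<and> R (step N c) e" if "R c d" for c d
  proof -
    obtain q Ts Us where c: "c = (q, Ts)" and d: "d = (nstates M + q, Us)"
      and Us: "\<And>j. j < ntapes N \<Longrightarrow> Us (comp_tape M j) = Ts j"
      using \<open>R c d\<close> by (cases c; cases d) (auto simp: R_def)
    obtain q' Ts' where step: "step N c = (q', Ts')"
      by force
    obtain Us' where "step (comp_tm M N) d = (nstates M + q', Us')"
      and "\<And>j. j < ntapes N \<Longrightarrow> Us' (comp_tape M j) = Ts' j"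
      using step_comp_tm_second[OF assms(1,2) Us step[unfolded c]] unfolding d by blast
    then have "reaches (comp_tm M N) 1 d (nstates M + q', Us')" "R (step N c) (nstates M + q', Us')"
      by (auto intro: reaches_step simp: R_def step simp del: One_nat_def)
    then show ?thesis
      by blast
  qed
  have "R (q, Ts) (nstates M + q, Us)"
    using assms(4) by (simp add: R_def)
  from reaches_simulation[OF assms(3) this simulation] show thesis
    using that by (auto simp: R_def)
qed

lemma outputs_within_comp_tm:
  assumes M: "is_tm M" and N: "is_tm N"
    and f: "outputs_within M [x] s y" and g: "outputs_within N [y] t z"
  shows "outputs_within (comp_tm M N) [x] (s + t) z"
proof -
  obtain Ts where Ts: "reaches M s (init [x]) (nstates M, Ts)" "Ts 0 = tape_of y"
    using f by (auto simp: outputs_within_iff_reaches)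
  obtain Ts' where Ts': "reaches N t (init [y]) (nstates N, Ts')" "Ts' 0 = tape_of z"
    using g by (auto simp: outputs_within_iff_reaches)
  note ntapes_pos = M[THEN is_tmD(1)] N[THEN is_tmD(1)]
  have "snd (init [x]) i = tape_of []" if "ntapes M \<le> i" for i
    using that ntapes_pos by (simp add: init_def)
  note first = reaches_comp_tm_first[OF M Ts(1) this]
  have "Ts (comp_tape M j) = snd (init [y]) j" for j
    using first(2) Ts(2) by (auto simp: comp_tape_def init_def)
  moreover have "reaches N t (0, snd (init [y])) (nstates N, Ts')"
    using Ts'(1) by (simp add: init_def)
  ultimately obtain Us where
    second: "reaches (comp_tm M N) t (nstates M + 0, Ts) (nstates M + nstates N, Us)"
    and Us: "\<And>j. j < ntapes N \<Longrightarrow> Us (comp_tape M j) = Ts' j"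
    using reaches_comp_tm_second[OF M N, of t 0 "snd (init [y])"] by metis
  have "reaches (comp_tm M N) (s + t) (init [x]) (nstates (comp_tm M N), Us)"
    using reaches_trans[OF first(1)] second by (simp add: nstates_comp_tm)
  moreover have "Us 0 = tape_of z"
    using Us[of 0] ntapes_pos Ts'(2) by (simp add: comp_tape_def)
  ultimately show ?thesis
    using ntapes_pos by (auto simp: outputs_within_iff_reaches ntapes_comp_tm)
qed

section \<open>Polynomial-time conversions between encodings\<close>

text \<open>
  Nothing is required of words that are not of the form \<open>e a\<close>, so a machine for encoded digraphs
  need not recognize malformed inputs.
\<close>

definition polytime_converts :: "'a set \<Rightarrow> ('a \<Rightarrow> bool list) \<Rightarrow> ('a \<Rightarrow> bool list) \<Rightarrow> bool" where
  "polytime_converts A e f \<longleftrightarrow>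
     (\<exists>M (p :: nat poly). is_tm M \<and>
        (\<forall>a\<in>A. outputs_within M [e a] (poly p (length (e a))) (f a)))"

lemma polytime_computable_iff_polytime_converts:
  "polytime_computable f \<longleftrightarrow> polytime_converts UNIV id f"
  by (simp add: polytime_computable_def polytime_converts_def)

lemma polytime_converts_reindex:
  "polytime_converts B e f \<Longrightarrow> h ` A \<subseteq> B \<Longrightarrow> polytime_converts A (e \<circ> h) (f \<circ> h)"
  unfolding polytime_converts_def by fastforce

lemma polytime_converts_subset:
  "polytime_converts B e f \<Longrightarrow> A \<subseteq> B \<Longrightarrow> polytime_converts A e f"
  unfolding polytime_converts_def by blast

lemma polytime_converts_refl: "polytime_converts A e e"
proof -
  define M where "M = \<lparr> ntapes = 1, nstates = 0, delta = \<lambda>_ _. (0, []) \<rparr>"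
  have "outputs_within M [x] (poly 0 (length x)) x" for x
    by (simp add: outputs_within_def init_def M_def)
  then show ?thesis
    unfolding polytime_converts_def by (intro exI[of _ M] exI[of _ 0]) (simp add: is_tm_def M_def)
qed

lemma poly_nat_mono:
  fixes p :: "nat poly"
  shows "m \<le> n \<Longrightarrow> poly p m \<le> poly p n"
  by (induction p) (auto intro!: add_mono mult_mono)

lemma polytime_converts_trans:
  assumes "polytime_converts A e f" "polytime_converts A f g"
  shows "polytime_converts A e g"
proof -
  obtain M and p :: "nat poly" where M: "is_tm M"
    and f: "\<And>a. a \<in> A \<Longrightarrow> outputs_within M [e a] (poly p (length (e a))) (f a)"
    using assms(1) by (auto simp: polytime_converts_def)
  obtain N and q :: "nat poly" where N: "is_tm N"
    and g: "\<And>a. a \<in> A \<Longrightarrow> outputs_within N [f a] (poly q (length (f a))) (g a)"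
    using assms(2) by (auto simp: polytime_converts_def)
  define r where "r = p + q \<circ>\<^sub>p ([:1, 1:] + p)"
  have "outputs_within (comp_tm M N) [e a] (poly r (length (e a))) (g a)" if "a \<in> A" for a
  proof (rule outputs_within_mono)
    show "outputs_within (comp_tm M N) [e a] (poly p (length (e a)) + poly q (length (f a))) (g a)"
      using M N f[OF that] g[OF that] by (rule outputs_within_comp_tm)
    have "poly q (length (f a)) \<le> poly q (Suc (length (e a) + poly p (length (e a))))"
      using length_output_le[OF f[OF that]] by (rule poly_nat_mono)
    then show "poly p (length (e a)) + poly q (length (f a)) \<le> poly r (length (e a))"
      by (simp add: r_def poly_pcompose)
  qed
  then show ?thesis
    unfolding polytime_converts_def using is_tm_comp_tm[OF M N] by blast
qed

lemma polytime_converts_funpow: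
  assumes "polytime_converts A e (e \<circ> F)" "F ` A \<subseteq> A"
  shows "polytime_converts A e (e \<circ> (F ^^ i))"
proof (induction i)
  case 0
  show ?case
    by (simp add: polytime_converts_refl)
next
  case (Suc i)
  have "(F ^^ i) ` A \<subseteq> A"
    using assms(2) by (induction i) auto
  from polytime_converts_reindex[OF assms(1) this]
  have "polytime_converts A (e \<circ> (F ^^ i)) (e \<circ> (F ^^ Suc i))"
    by (simp add: comp_assoc)
  with Suc show ?case
    by (rule polytime_converts_trans)
qed

section \<open>Transfer of NP-hardness\<close>

lemma NP_hard_mono:
  assumes "NP_hard P" "fst P \<subseteq> fst Q" "snd P \<subseteq> snd Q"
  shows "NP_hard Q"
  using assms unfolding NP_hard_def reduces_to_def by (meson subsetD)

lemma NP_hard_image_if_polytime_converts: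
  assumes "NP_hard (e ` Y, e ` N)" "polytime_converts (Y \<union> N) e f"
  shows "NP_hard (f ` Y, f ` N)"
  unfolding NP_hard_def
proof (intro allI impI)
  fix L
  assume "in_NP L"
  then obtain r where r: "polytime_computable r"
    "\<And>x. (x \<in> L \<longrightarrow> r x \<in> e ` Y) \<and> (x \<notin> L \<longrightarrow> r x \<in> e ` N)"
    using assms(1) by (auto simp: NP_hard_def reduces_to_def)
  then have "\<exists>a. r x = e a \<and> (x \<in> L \<longrightarrow> a \<in> Y) \<and> (x \<notin> L \<longrightarrow> a \<in> N)" for x
    by (cases "x \<in> L") auto
  then obtain a where a: "\<And>x. r x = e (a x)" "\<And>x. x \<in> L \<Longrightarrow> a x \<in> Y" "\<And>x. x \<notin> L \<Longrightarrow> a x \<in> N"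
    by metis
  have "polytime_converts UNIV id (e \<circ> a)"
    using r(1) a(1) by (simp add: polytime_computable_iff_polytime_converts comp_def flip: a(1))
  moreover have "range a \<subseteq> Y \<union> N"
    using a(2,3) by blast
  then have "polytime_converts UNIV (e \<circ> a) (f \<circ> a)"
    using assms(2) by (intro polytime_converts_reindex)
  ultimately have "polytime_computable (f \<circ> a)"
    unfolding polytime_computable_iff_polytime_converts by (rule polytime_converts_trans)
  then show "reduces_to L (f ` Y, f ` N)"
    unfolding reduces_to_def using a(2,3) by (intro exI[of _ "f \<circ> a"]) auto
qed

lemma NP_hard_PCSP_transfer:
  assumes "NP_hard (PCSP H G)"
    and "polytime_converts (Collect instance_digraph) encode (encode \<circ> F)"
    and inst: "\<And>I. instance_digraph I \<Longrightarrow> instance_digraph (F I)"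
    and yes: "\<And>I. instance_digraph I \<Longrightarrow> I \<rightarrow>\<^sub>h H \<Longrightarrow> F I \<rightarrow>\<^sub>h H'"
    and no: "\<And>I. instance_digraph I \<Longrightarrow> F I \<rightarrow>\<^sub>h G' \<Longrightarrow> I \<rightarrow>\<^sub>h G"
  shows "NP_hard (PCSP H' G')"
proof (rule NP_hard_mono)
  define Y where "Y = {I. instance_digraph I \<and> I \<rightarrow>\<^sub>h H}"
  define N where "N = {I. instance_digraph I \<and> \<not> I \<rightarrow>\<^sub>h G}"
  have "PCSP H G = (encode ` Y, encode ` N)"
    by (simp add: PCSP_def setcompr_eq_image Y_def N_def)
  with assms(1) have "NP_hard (encode ` Y, encode ` N)"
    by simp
  moreover have "polytime_converts (Y \<union> N) encode (encode \<circ> F)"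
    using assms(2) by (rule polytime_converts_subset) (auto simp: Y_def N_def)
  ultimately show "NP_hard ((encode \<circ> F) ` Y, (encode \<circ> F) ` N)"
    by (rule NP_hard_image_if_polytime_converts)
  show "fst ((encode \<circ> F) ` Y, (encode \<circ> F) ` N) \<subseteq> fst (PCSP H' G')"
    using inst yes unfolding PCSP_def Y_def by fastforce
  show "snd ((encode \<circ> F) ` Y, (encode \<circ> F) ` N) \<subseteq> snd (PCSP H' G')"
    using inst no unfolding PCSP_def N_def by fastforce
qed

section \<open>Structured programs\<close>

datatype prog =
    Write nat "(nat \<Rightarrow> sym) \<Rightarrow> sym" dir
  | Seq prog prog (infixl \<open>;;\<close> 60)
  | While "(nat \<Rightarrow> sym) \<Rightarrow> bool" prog

definition scan :: "nat \<Rightarrow> (nat \<Rightarrow> tape) \<Rightarrow> nat \<Rightarrow> sym" where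
  "scan k Ts i = (if i < k then Ts i 0 else None)"

abbreviation input_tapes :: "bool list \<Rightarrow> nat \<Rightarrow> tape" where
  "input_tapes x \<equiv> (\<lambda>_. tape_of [])(0 := tape_of x)"

inductive runs :: "nat \<Rightarrow> prog \<Rightarrow> nat \<Rightarrow> (nat \<Rightarrow> tape) \<Rightarrow> (nat \<Rightarrow> tape) \<Rightarrow> bool" for k where
  runs_Write: "i < k \<Longrightarrow> runs k (Write i f d) 1 Ts (Ts(i := act (f (scan k Ts), d) (Ts i)))"
| runs_Seq [trans]: "runs k p s Ts Us \<Longrightarrow> runs k q t Us Vs \<Longrightarrow> runs k (p ;; q) (s + t) Ts Vs"
| runs_While_stop: "\<not> b (scan k Ts) \<Longrightarrow> runs k (While b p) 1 Ts Ts"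
| runs_While_iterate: "b (scan k Ts) \<Longrightarrow> runs k p s Ts Us \<Longrightarrow> runs k (While b p) t Us Vs
    \<Longrightarrow> runs k (While b p) (1 + (s + t)) Ts Vs"
| runs_mono: "runs k p s Ts Us \<Longrightarrow> s \<le> t \<Longrightarrow> runs k p t Ts Us"

lemma runs_While:
  assumes "\<And>j. j < N \<Longrightarrow> b (scan k (S j))" "\<And>j. j < N \<Longrightarrow> runs k p t (S j) (S (Suc j))"
    and "\<not> b (scan k (S N))"
  shows "runs k (While b p) (N * (t + 1) + 1) (S 0) (S N)"
  using assms
proof (induction N arbitrary: S)
  case 0
  then show ?case
    by (simp add: runs_While_stop[unfolded One_nat_def])
next
  case (Suc N)
  have "runs k (While b p) (N * (t + 1) + 1) (S (Suc 0)) (S (Suc N))"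
    using Suc.prems by (intro Suc.IH[of "\<lambda>j. S (Suc j)"]) auto
  with Suc.prems(1,2)[of 0]
  have "runs k (While b p) (1 + (t + (N * (t + 1) + 1))) (S 0) (S (Suc N))"
    by (intro runs_While_iterate) auto
  then show ?case
    by (simp add: algebra_simps)
qed

fun prog_size :: "prog \<Rightarrow> nat" where
  "prog_size (Write i f d) = 1"
| "prog_size (p ;; q) = prog_size p + prog_size q"
| "prog_size (While b p) = Suc (prog_size p)"

text \<open>
  \<open>code p a e\<close> is the transition function of \<open>p\<close> on the states \<open>a, \<dots>, a + prog_size p - 1\<close>
  with entry \<open>a\<close> and exit \<open>e\<close>.
\<close>

fun code :: "prog \<Rightarrow> nat \<Rightarrow> nat \<Rightarrow> nat \<Rightarrow> (nat \<Rightarrow> sym) \<Rightarrow> nat \<times> (nat \<Rightarrow> sym \<times> dir)" where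
  "code (Write i f d) a e q r = (e, \<lambda>j. if j = i then (f r, d) else (r j, Stay))"
| "code (p ;; p') a e q r =
     (if q < a + prog_size p then code p a (a + prog_size p) q r
      else code p' (a + prog_size p) e q r)"
| "code (While b p) a e q r =
     (if q = a then (if b r then Suc a else e, \<lambda>j. (r j, Stay))
      else code p (Suc a) a q r)"

definition prog_tm :: "nat \<Rightarrow> prog \<Rightarrow> tm" where
  "prog_tm k p = \<lparr> ntapes = k, nstates = prog_size p,
     delta = (\<lambda>q rs. let (q', as) = code p 0 (prog_size p) q (\<lambda>i. if i < k then rs ! i else None)
       in (q', map as [0..<k])) \<rparr>"

lemma prog_size_pos: "0 < prog_size p"
  by (induction p) auto

lemma code_exit_le:
  assumes "a \<le> q" "q < a + prog_size p" "a + prog_size p \<le> m" "e \<le> m"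
  shows "fst (code p a e q r) \<le> m"
  using assms
proof (induction p arbitrary: a e)
  case (While b p)
  then show ?case
    using prog_size_pos[of p] by auto
qed auto

lemma is_tm_prog_tm: "1 \<le> k \<Longrightarrow> is_tm (prog_tm k p)"
  using code_exit_le[of 0 _ p "prog_size p"] by (simp add: is_tm_def prog_tm_def case_prod_beta)

definition perform :: "nat \<Rightarrow> (nat \<Rightarrow> sym \<times> dir) \<Rightarrow> (nat \<Rightarrow> tape) \<Rightarrow> nat \<Rightarrow> tape" where
  "perform k as Ts = (\<lambda>i. if i < k then act (as i) (Ts i) else Ts i)"

lemma perform_Stay: "perform k (\<lambda>i. (scan k Ts i, Stay)) Ts = Ts"
  by (simp add: perform_def scan_def act_scanned_Stay fun_eq_iff)

lemma perform_single:
  "i < k \<Longrightarrow> perform k (\<lambda>j. if j = i then a else (scan k Ts j, Stay)) Ts = Ts(i := act a (Ts i))"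
  by (simp add: perform_def scan_def act_scanned_Stay fun_eq_iff)

definition implements :: "tm \<Rightarrow> prog \<Rightarrow> nat \<Rightarrow> nat \<Rightarrow> bool" where
  "implements M p a e \<longleftrightarrow> (\<forall>q Ts. a \<le> q \<longrightarrow> q < a + prog_size p \<longrightarrow>
     step M (q, Ts) = (let (q', as) = code p a e q (scan (ntapes M) Ts)
       in (q', perform (ntapes M) as Ts)))"

lemma implements_prog_tm: "implements (prog_tm k p) p 0 (prog_size p)"
proof -
  have "(\<lambda>i. if i < k then map (\<lambda>i. Ts i 0) [0..<k] ! i else None) = scan k Ts"
    for Ts :: "nat \<Rightarrow> tape"
    by (simp add: scan_def fun_eq_iff)
  then show ?thesis
    by (auto simp: implements_def step_def prog_tm_def perform_def case_prod_beta Let_def)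
qed

lemma implements_Seq:
  assumes "implements M (p ;; q) a e"
  shows "implements M p a (a + prog_size p)" "implements M q (a + prog_size p) e"
  using assms by (auto simp: implements_def)

lemma implements_While:
  assumes "implements M (While b p) a e"
  shows "implements M p (Suc a) a"
    and "step M (a, Ts) = (if b (scan (ntapes M) Ts) then Suc a else e, Ts)"
  using assms by (auto simp: implements_def perform_Stay)

lemma reaches_if_runs:
  assumes "runs (ntapes M) p t Ts Us" "implements M p a e"
  shows "reaches M t (a, Ts) (e, Us)"
  using assms
proof (induction arbitrary: a e rule: runs.induct)
  case (runs_Write i f d Ts)
  then have "step M (a, Ts) = (e, Ts(i := act (f (scan (ntapes M) Ts), d) (Ts i)))"
    by (simp add: implements_def perform_single)
  then show ?case
    by (rule reaches_step)
next
  case (runs_Seq p s Ts Us q t Vs)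
  then show ?case
    using implements_Seq reaches_trans by blast
next
  case (runs_While_stop b Ts p)
  then show ?case
    using implements_While(2)[OF runs_While_stop.prems, of Ts] by (intro reaches_step) simp
next
  case (runs_While_iterate b Ts p s Us t Vs)
  have "reaches M 1 (a, Ts) (Suc a, Ts)"
    using implements_While(2)[OF runs_While_iterate.prems, of Ts] runs_While_iterate.hyps(1)
    by (intro reaches_step) simp
  also have "reaches M s (Suc a, Ts) (a, Us)"
    using implements_While(1)[OF runs_While_iterate.prems] by (rule runs_While_iterate.IH)
  also have "reaches M t (a, Us) (e, Vs)"
    using runs_While_iterate.prems by (rule runs_While_iterate.IH)
  finally show ?case
    by (simp add: add.assoc)
next
  case (runs_mono p s Ts Us t)
  then show ?case
    using reaches_mono by blast
qed

lemma outputs_within_prog_tm: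
  assumes "runs k p t (input_tapes x) Ts" "Ts 0 = tape_of y" "1 \<le> k"
  shows "outputs_within (prog_tm k p) [x] t y"
proof -
  have "init [x] = (0, input_tapes x)"
    by (auto simp: init_def)
  moreover have "ntapes (prog_tm k p) = k" "nstates (prog_tm k p) = prog_size p"
    by (simp_all add: prog_tm_def)
  ultimately show ?thesis
    using assms reaches_if_runs[OF _ implements_prog_tm, of k p t]
    by (auto simp: outputs_within_iff_reaches)
qed

section \<open>Programs on words\<close>

definition tape_at :: "bool list \<Rightarrow> int \<Rightarrow> tape" where
  "tape_at w p = (\<lambda>i. tape_of w (i + p))"

abbreviation tape_end :: "bool list \<Rightarrow> tape" where
  "tape_end w \<equiv> tape_at w (int (length w))"

lemma tape_at_0 [simp]: "tape_at w 0 = tape_of w"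
  by (simp add: tape_at_def)

lemma scanned_tape_at:
  "tape_at w p 0 = (if 0 \<le> p \<and> p < int (length w) then Some (w ! nat p) else None)"
  by (simp add: tape_at_def tape_of_def)

lemma scanned_tape_of: "tape_of w 0 = (if w = [] then None else Some (hd w))"
  by (simp add: tape_of_def hd_conv_nth)

lemma act_tape_at: "act (tape_at w p 0, d) (tape_at w p) = tape_at w (p + offset d)"
  by (simp add: act_def) (simp add: tape_at_def algebra_simps)

lemma act_tape_end: "act (Some b, Right) (tape_end w) = tape_end (w @ [b])"
  by (auto simp: act_def tape_at_def tape_of_def fun_eq_iff nth_append algebra_simps)

lemma act_tape_of_Cons: "act (None, Right) (tape_of (b # w)) = tape_of w"
  by (auto simp: act_def tape_of_def fun_eq_iff nth_Cons' nat_add_distrib)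

lemma runs_append:
  assumes "i < k" "Ts i = tape_end w" "f (scan k Ts) = Some b"
  shows "runs k (Write i f Right) 1 Ts (Ts(i := tape_end (w @ [b])))"
  using runs_Write[OF assms(1), of f Right Ts] assms(2,3) by (simp add: act_tape_end)

lemma runs_erase:
  assumes "i < k" "Ts i = tape_of (b # w)"
  shows "runs k (Write i (\<lambda>_. None) Right) 1 Ts (Ts(i := tape_of w))"
  using runs_Write[OF assms(1), of "\<lambda>_. None" Right Ts] assms(2) by (simp add: act_tape_of_Cons)

definition move :: "nat \<Rightarrow> dir \<Rightarrow> prog" where
  "move i = Write i (\<lambda>r. r i)"

lemma runs_move:
  assumes "i < k" "Ts i = tape_at w p"
  shows "runs k (move i d) 1 Ts (Ts(i := tape_at w (p + offset d)))"
  using runs_Write[OF assms(1), of "\<lambda>r. r i" d Ts] assms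
  by (simp add: move_def scan_def act_tape_at)

definition rewind :: "nat \<Rightarrow> prog" where
  "rewind i = move i Left ;; While (\<lambda>r. r i \<noteq> None) (move i Left) ;; move i Right"

lemma runs_rewind:
  assumes "i < k" "Ts i = tape_end w"
  shows "runs k (rewind i) (2 * length w + 3) Ts (Ts(i := tape_of w))"
proof -
  define S where "S j = Ts(i := tape_at w (int (length w) - 1 - int j))" for j
  have "runs k (move i Left) 1 Ts (S 0)"
    using runs_move[of i k Ts w "int (length w)" Left] assms by (simp add: S_def)
  also have "runs k (While (\<lambda>r. r i \<noteq> None) (move i Left)) (length w * (1 + 1) + 1) \<dots>
      (S (length w))"
  proof (rule runs_While)
    fix j
    show "runs k (move i Left) 1 (S j) (S (Suc j))"
      using runs_move[OF assms(1), of "S j" w "int (length w) - 1 - int j" Left]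
      by (simp add: S_def algebra_simps)
  qed (use assms(1) in \<open>simp_all add: S_def scan_def scanned_tape_at\<close>)
  also have "runs k (move i Right) 1 \<dots> (Ts(i := tape_of w))"
    using runs_move[OF assms(1), of "S (length w)" w "- 1" Right] by (simp add: S_def)
  finally show ?thesis
    unfolding rewind_def by (rule runs_mono) simp
qed

definition for_each :: "nat \<Rightarrow> prog \<Rightarrow> prog" where
  "for_each i p = While (\<lambda>r. r i \<noteq> None) (p ;; move i Right) ;; rewind i"

lemma runs_for_each:
  assumes i: "i < k" and S: "\<And>j. S j i = tape_at w (int j)"
    and p: "\<And>j. j < length w \<Longrightarrow> runs k p t (S j) ((S (Suc j))(i := tape_at w (int j)))"
  shows "runs k (for_each i p) (length w * (t + 4) + 4) (S 0) ((S (length w))(i := tape_of w))"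
proof -
  have "runs k (While (\<lambda>r. r i \<noteq> None) (p ;; move i Right)) (length w * ((t + 1) + 1) + 1)
      (S 0) (S (length w))"
  proof (rule runs_While)
    fix j
    assume "j < length w"
    then have "runs k p t (S j) ((S (Suc j))(i := tape_at w (int j)))"
      by (rule p)
    also have "runs k (move i Right) 1 \<dots> (S (Suc j))"
      using runs_move[OF i, of "(S (Suc j))(i := tape_at w (int j))" w "int j" Right] S[of "Suc j"]
      by (simp add: fun_upd_idem add.commute)
    finally show "runs k (p ;; move i Right) (t + 1) (S j) (S (Suc j))" .
  qed (use i in \<open>simp_all add: scan_def S scanned_tape_at\<close>)
  also have "runs k (rewind i) (2 * length w + 3) \<dots> ((S (length w))(i := tape_of w))"
    using i S by (rule runs_rewind)
  finally show ?thesis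
    unfolding for_each_def by (rule runs_mono) (simp add: algebra_simps)
qed

lemma runs_for_each_move:
  assumes "i < k" "j < k" "i \<noteq> j" "Ts i = tape_of w" "Ts j = tape_at v p"
  shows "runs k (for_each i (move j d)) (length w * 5 + 4) Ts
    (Ts(j := tape_at v (p + int (length w) * offset d)))"
proof -
  define S where "S l = Ts(i := tape_at w (int l), j := tape_at v (p + int l * offset d))" for l
  have "runs k (for_each i (move j d)) (length w * (1 + 4) + 4) (S 0)
      ((S (length w))(i := tape_of w))"
  proof (rule runs_for_each)
    fix l
    have "(S l)(j := tape_at v (p + int l * offset d + offset d))
        = (S (Suc l))(i := tape_at w (int l))"
      using assms(3) by (auto simp: S_def fun_eq_iff algebra_simps)
    then show "runs k (move j d) 1 (S l) ((S (Suc l))(i := tape_at w (int l)))"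
      using runs_move[OF assms(2), of "S l" v "p + int l * offset d" d] by (simp add: S_def)
  qed (use assms in \<open>simp_all add: S_def\<close>)
  moreover have "S 0 = Ts"
    using assms(4,5) by (auto simp: S_def)
  moreover have "(S (length w))(i := tape_of w)
      = Ts(j := tape_at v (p + int (length w) * offset d))"
    using assms(3,4) by (auto simp: S_def fun_eq_iff)
  ultimately show ?thesis
    by simp
qed

definition copy :: "nat \<Rightarrow> nat \<Rightarrow> prog" where
  "copy i j = for_each i (Write j (\<lambda>r. r i) Right) ;; rewind j"

lemma runs_copy:
  assumes "i < k" "j < k" "i \<noteq> j" "Ts i = tape_of w" "Ts j = tape_of []"
  shows "runs k (copy i j) (7 * length w + 7) Ts (Ts(j := tape_of w))"
proof -
  define S where "S l = Ts(i := tape_at w (int l), j := tape_at (take l w) (int l))" for l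
  have "S 0 = Ts"
    using assms(4,5) by (auto simp: S_def)
  then have "runs k (for_each i (Write j (\<lambda>r. r i) Right)) (length w * (1 + 4) + 4) Ts
      ((S (length w))(i := tape_of w))"
  proof (rule subst, intro runs_for_each)
    fix l
    assume l: "l < length w"
    then have "runs k (Write j (\<lambda>r. r i) Right) 1 (S l) ((S l)(j := tape_end (take l w @ [w ! l])))"
      using assms(1-3) by (intro runs_append) (simp_all add: S_def scan_def scanned_tape_at min_def)
    also have "\<dots> = (S (Suc l))(i := tape_at w (int l))"
      using assms(3) l by (auto simp: S_def fun_eq_iff take_Suc_conv_app_nth min_def)
    finally show "runs k (Write j (\<lambda>r. r i) Right) 1 (S l) ((S (Suc l))(i := tape_at w (int l)))" .
  qed (use assms(1-3) in \<open>simp_all add: S_def\<close>)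
  also have "\<dots> = Ts(j := tape_end w)"
    using assms(3,4) by (auto simp: S_def fun_eq_iff)
  also have "runs k (rewind j) (2 * length w + 3) \<dots> (Ts(j := tape_of w))"
    using runs_rewind[OF assms(2), of "Ts(j := tape_end w)"] by simp
  finally show ?thesis
    unfolding copy_def by (rule runs_mono) simp
qed

definition transfer :: "nat \<Rightarrow> nat \<Rightarrow> (sym \<Rightarrow> bool) \<Rightarrow> prog" where
  "transfer i j P =
     While (\<lambda>r. P (r i)) (Write j (\<lambda>r. r i) Right ;; Write i (\<lambda>_. None) Right) ;; rewind j"

lemma runs_transfer:
  assumes "i < k" "j < k" "i \<noteq> j" "Ts i = tape_of (w @ w')" "Ts j = tape_of []"
    and "\<And>b. b \<in> set w \<Longrightarrow> P (Some b)" "\<not> P (tape_of w' 0)"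
  shows "runs k (transfer i j P) (5 * length w + 4) Ts (Ts(i := tape_of w', j := tape_of w))"
proof -
  define S where "S l = Ts(i := tape_of (drop l w @ w'), j := tape_end (take l w))" for l
  have "S 0 = Ts"
    using assms(4,5) by (auto simp: S_def)
  then have "runs k (While (\<lambda>r. P (r i)) (Write j (\<lambda>r. r i) Right ;; Write i (\<lambda>_. None) Right))
      (length w * ((1 + 1) + 1) + 1) Ts (S (length w))"
  proof (rule subst, intro runs_While)
    fix l
    assume l: "l < length w"
    then have drop: "drop l w = w ! l # drop (Suc l) w"
      by (simp add: Cons_nth_drop_Suc)
    show "P (scan k (S l) i)"
      using assms(1,3,6) l by (simp add: S_def scan_def scanned_tape_of drop)
    have "runs k (Write j (\<lambda>r. r i) Right) 1 (S l) ((S l)(j := tape_end (take l w @ [w ! l])))"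
      using assms(1-3) by (intro runs_append) (simp_all add: S_def scan_def scanned_tape_of drop)
    also have "runs k (Write i (\<lambda>_. None) Right) 1 \<dots> (\<dots>(i := tape_of (drop (Suc l) w @ w')))"
      using assms(1,3) drop by (intro runs_erase) (simp_all add: S_def)
    also have "\<dots> = S (Suc l)"
      using assms(3) l by (auto simp: S_def fun_eq_iff take_Suc_conv_app_nth)
    finally show "runs k (Write j (\<lambda>r. r i) Right ;; Write i (\<lambda>_. None) Right) (1 + 1)
        (S l) (S (Suc l))" .
  qed (use assms(1,3,7) in \<open>simp_all add: S_def scan_def\<close>)
  also have "runs k (rewind j) (2 * length w + 3) \<dots> (\<dots>(j := tape_of w))"
    using assms(2) by (intro runs_rewind) (simp_all add: S_def)
  also have "\<dots> = Ts(i := tape_of w', j := tape_of w)"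
    by (simp add: S_def)
  finally show ?thesis
    unfolding transfer_def by (rule runs_mono) simp
qed

section \<open>A program for the arc digraph\<close>

text \<open>
  The input \<open>1\<^sup>n 0 A\<close> is consumed from tape \<open>0\<close>, which then receives the output. Tapes \<open>1\<close> and \<open>2\<close>
  hold the adjacency bits \<open>A\<close>, tapes \<open>3\<close> to \<open>6\<close> hold \<open>n\<close> in unary. The loops over tapes \<open>3\<close> and
  \<open>4\<close> enumerate the pairs \<open>(u, v)\<close>, whose entry of \<open>A\<close> is scanned on tape \<open>1\<close>, and the loop over
  tape \<open>2\<close> enumerates the columns of the output matrix. In the row of \<open>(u, v)\<close>, the head of tape \<open>5\<close>
  starts at position \<open>- v * n\<close> and moves along with the column index, so that it scans a nonblank
  cell exactly for the columns \<open>(v, w)\<close>. Tape \<open>6\<close> is used to move it back.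
\<close>

definition read_input :: prog where
  "read_input = transfer 0 3 (\<lambda>s. s = Some True) ;; Write 0 (\<lambda>_. None) Right ;;
     transfer 0 1 (\<lambda>s. s \<noteq> None) ;; copy 1 2 ;; copy 3 4 ;; copy 3 5 ;; copy 3 6"

definition write_header :: prog where
  "write_header = for_each 2 (Write 0 (\<lambda>_. Some True) Right) ;; Write 0 (\<lambda>_. Some False) Right"

definition write_entry :: prog where
  "write_entry =
     Write 0 (\<lambda>r. Some (r 1 = Some True \<and> r 2 = Some True \<and> r 5 \<noteq> None)) Right ;; move 5 Right"

definition write_row :: prog where
  "write_row = for_each 2 write_entry ;; for_each 2 (move 5 Left) ;; for_each 6 (move 5 Left) ;;
     move 1 Right"

definition write_block :: prog where
  "write_block = for_each 4 write_row ;; for_each 2 (move 5 Right)"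

definition arc_prog :: prog where
  "arc_prog = read_input ;; write_header ;; for_each 3 write_block ;; rewind 0"

definition arc_prog_bound :: "nat poly" where
  "arc_prog_bound = [:51, 57, 24, 16:]"

definition arc_bit :: "nat \<Rightarrow> bool list \<Rightarrow> nat \<Rightarrow> nat \<Rightarrow> bool" where
  "arc_bit n A p j \<longleftrightarrow> A ! p \<and> A ! j \<and> j div n = p mod n"

definition row_bits :: "nat \<Rightarrow> bool list \<Rightarrow> nat \<Rightarrow> bool list" where
  "row_bits n A p = map (arc_bit n A p) [0..<length A]"

abbreviation rows_bits :: "nat \<Rightarrow> bool list \<Rightarrow> nat \<Rightarrow> bool list" where
  "rows_bits n A k \<equiv> concat (map (row_bits n A) [0..<k])"

definition arc_word :: "nat \<Rightarrow> bool list \<Rightarrow> bool list" where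
  "arc_word n A = replicate (n * n) True @ False # rows_bits n A (n * n)"

definition arc_tapes ::
  "nat \<Rightarrow> bool list \<Rightarrow> bool list \<Rightarrow> int \<Rightarrow> int \<Rightarrow> int \<Rightarrow> int \<Rightarrow> int \<Rightarrow> nat \<Rightarrow> tape" where
  "arc_tapes n A out p j u v z = (\<lambda>_. tape_of [])
     (0 := tape_end out, 1 := tape_at A p, 2 := tape_at A j, 3 := tape_at (replicate n True) u,
      4 := tape_at (replicate n True) v, 5 := tape_at (replicate n True) z,
      6 := tape_of (replicate n True))"

lemma arc_tapes_apply:
  "arc_tapes n A out p j u v z 0 = tape_end out"
  "arc_tapes n A out p j u v z (Suc 0) = tape_at A p"
  "arc_tapes n A out p j u v z 2 = tape_at A j"
  "arc_tapes n A out p j u v z 3 = tape_at (replicate n True) u"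
  "arc_tapes n A out p j u v z 4 = tape_at (replicate n True) v"
  "arc_tapes n A out p j u v z 5 = tape_at (replicate n True) z"
  "arc_tapes n A out p j u v z 6 = tape_of (replicate n True)"
  by (simp_all add: arc_tapes_def)

lemma arc_tapes_update:
  "(arc_tapes n A out p j u v z)(0 := tape_at w (int (length w))) = arc_tapes n A w p j u v z"
  "(arc_tapes n A out p j u v z)(Suc 0 := tape_at A p') = arc_tapes n A out p' j u v z"
  "(arc_tapes n A out p j u v z)(2 := tape_at A j') = arc_tapes n A out p j' u v z"
  "(arc_tapes n A out p j u v z)(2 := tape_of A) = arc_tapes n A out p 0 u v z"
  "(arc_tapes n A out p j u v z)(3 := tape_at (replicate n True) u') = arc_tapes n A out p j u' v z"
  "(arc_tapes n A out p j u v z)(3 := tape_of (replicate n True)) = arc_tapes n A out p j 0 v z"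
  "(arc_tapes n A out p j u v z)(4 := tape_at (replicate n True) v') = arc_tapes n A out p j u v' z"
  "(arc_tapes n A out p j u v z)(4 := tape_of (replicate n True)) = arc_tapes n A out p j u 0 z"
  "(arc_tapes n A out p j u v z)(5 := tape_at (replicate n True) z') = arc_tapes n A out p j u v z'"
  by (auto simp: arc_tapes_def fun_eq_iff)

lemma runs_read_input:
  "runs 7 read_input (26 * n + 12 * length A + 37)
     (input_tapes (replicate n True @ False # A)) (arc_tapes n A [] 0 0 0 0 0)"
proof -
  let ?blank = "(\<lambda>_. tape_of []) :: nat \<Rightarrow> tape" and ?u = "tape_of (replicate n True)"
  have "runs 7 (transfer 0 3 (\<lambda>s. s = Some True)) (5 * length (replicate n True) + 4)
      (?blank(0 := tape_of (replicate n True @ False # A)))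
      (?blank(0 := tape_of (replicate n True @ False # A), 0 := tape_of (False # A), 3 := ?u))"
    by (rule runs_transfer) (simp_all add: scanned_tape_of)
  also have "\<dots> = ?blank(0 := tape_of (False # A), 3 := ?u)"
    by simp
  also have "runs 7 (Write 0 (\<lambda>_. None) Right) 1 \<dots> (\<dots>(0 := tape_of A))"
    by (rule runs_erase) simp_all
  also have "\<dots> = ?blank(0 := tape_of A, 3 := ?u)"
    by auto
  also have "runs 7 (transfer 0 1 (\<lambda>s. s \<noteq> None)) (5 * length A + 4) \<dots>
      (\<dots>(0 := tape_of [], 1 := tape_of A))"
    by (rule runs_transfer) (simp_all add: scanned_tape_of)
  also have "\<dots> = ?blank(1 := tape_of A, 3 := ?u)"
    by auto
  also have "runs 7 (copy 1 2) (7 * length A + 7) \<dots> (\<dots>(2 := tape_of A))"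
    by (rule runs_copy) simp_all
  also have "runs 7 (copy 3 4) (7 * length (replicate n True) + 7) \<dots> (\<dots>(4 := ?u))"
    by (rule runs_copy) simp_all
  also have "runs 7 (copy 3 5) (7 * length (replicate n True) + 7) \<dots> (\<dots>(5 := ?u))"
    by (rule runs_copy) simp_all
  also have "runs 7 (copy 3 6) (7 * length (replicate n True) + 7) \<dots> (\<dots>(6 := ?u))"
    by (rule runs_copy) simp_all
  also have "\<dots> = arc_tapes n A [] 0 0 0 0 0"
    by (auto simp: arc_tapes_def fun_eq_iff)
  finally show ?thesis
    unfolding read_input_def by (rule runs_mono) simp
qed

lemma runs_write_header:
  "runs 7 write_header (5 * length A + 5)
     (arc_tapes n A [] p 0 u v z) (arc_tapes n A (replicate (length A) True @ [False]) p 0 u v z)"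
proof -
  let ?S = "\<lambda>j. arc_tapes n A (replicate j True) p (int j) u v z"
  have "runs 7 (for_each 2 (Write 0 (\<lambda>_. Some True) Right)) (length A * (1 + 4) + 4)
      (?S 0) ((?S (length A))(2 := tape_of A))"
  proof (rule runs_for_each)
    fix j
    have "runs 7 (Write 0 (\<lambda>_. Some True) Right) 1 (?S j)
        ((?S j)(0 := tape_end (replicate j True @ [True])))"
      by (rule runs_append) (simp_all add: arc_tapes_apply)
    then show "runs 7 (Write 0 (\<lambda>_. Some True) Right) 1 (?S j)
        ((?S (Suc j))(2 := tape_at A (int j)))"
      by (simp only: arc_tapes_update replicate_append_same replicate_Suc)
  qed (simp_all add: arc_tapes_apply)
  also have "\<dots> = arc_tapes n A (replicate (length A) True) p 0 u v z"
    by (simp only: arc_tapes_update)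
  also have "runs 7 (Write 0 (\<lambda>_. Some False) Right) 1 \<dots>
      (\<dots>(0 := tape_end (replicate (length A) True @ [False])))"
    by (rule runs_append) (simp_all add: arc_tapes_apply)
  also have "\<dots> = arc_tapes n A (replicate (length A) True @ [False]) p 0 u v z"
    by (rule arc_tapes_update)
  finally show ?thesis
    by (simp add: write_header_def algebra_simps)
qed

lemma runs_write_entry:
  fixes p j n v :: nat
  assumes "p < length A" "j < length A" "p mod n = v" "0 < n"
  shows "runs 7 write_entry 2 (arc_tapes n A out p j u v (int j - int (v * n)))
    (arc_tapes n A (out @ [arc_bit n A p j]) p j u v (int (Suc j) - int (v * n)))"
proof -
  let ?z = "int j - int (v * n)" and ?bit = "arc_bit n A p j"
  have "j div n = v \<longleftrightarrow> v \<le> j div n \<and> j div n < Suc v"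
    by auto
  also have "\<dots> \<longleftrightarrow> v * n \<le> j \<and> j < Suc v * n"
    using assms(4) by (simp only: less_eq_div_iff_mult_less_eq div_less_iff_less_mult)
  also have "\<dots> \<longleftrightarrow> tape_at (replicate n True) ?z 0 \<noteq> None"
    by (auto simp: scanned_tape_at simp del: of_nat_mult)
  finally have "Some ?bit = Some (tape_at A p 0 = Some True \<and> tape_at A j 0 = Some True \<and>
      tape_at (replicate n True) ?z 0 \<noteq> None)"
    using assms(1-3) by (simp add: arc_bit_def scanned_tape_at)
  then have "runs 7 (Write 0 (\<lambda>r. Some (r 1 = Some True \<and> r 2 = Some True \<and> r 5 \<noteq> None)) Right) 1
      (arc_tapes n A out p j u v ?z) ((arc_tapes n A out p j u v ?z)(0 := tape_end (out @ [?bit])))"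
    by (intro runs_append) (simp_all add: scan_def arc_tapes_apply)
  also have "\<dots> = arc_tapes n A (out @ [?bit]) p j u v ?z"
    by (rule arc_tapes_update)
  also have "runs 7 (move 5 Right) 1 \<dots> (\<dots>(5 := tape_at (replicate n True) (?z + offset Right)))"
    by (rule runs_move) (simp_all add: arc_tapes_apply)
  also have "\<dots> = arc_tapes n A (out @ [?bit]) p j u v (int (Suc j) - int (v * n))"
    by (simp add: arc_tapes_update algebra_simps)
  finally show ?thesis
    unfolding write_entry_def by (rule runs_mono) simp
qed

lemma runs_move_window:
  fixes n :: nat and out A :: "bool list" and p u v z :: int
  defines "Ts \<equiv> arc_tapes n A out p 0 u v"
  shows "runs 7 (for_each 2 (move 5 d)) (length A * 5 + 4) (Ts z)
      (Ts (z + int (length A) * offset d))"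
    and "runs 7 (for_each 6 (move 5 d)) (n * 5 + 4) (Ts z) (Ts (z + int n * offset d))"
  using runs_for_each_move[of 2 7 5 "Ts z" A "replicate n True" z d]
    runs_for_each_move[of 6 7 5 "Ts z" "replicate n True" "replicate n True" z d]
  by (simp_all add: Ts_def arc_tapes_apply arc_tapes_update)

lemma runs_write_entries:
  fixes p n v :: nat
  assumes "p < length A" "p mod n = v" "0 < n"
  shows "runs 7 (for_each 2 write_entry) (6 * length A + 4)
    (arc_tapes n A out p 0 u v (- int (v * n)))
    (arc_tapes n A (out @ row_bits n A p) p 0 u v (int (length A) - int (v * n)))"
proof -
  let ?S = "\<lambda>j. arc_tapes n A (out @ map (arc_bit n A p) [0..<j]) p (int j) u v
    (int j - int (v * n))"
  have "runs 7 (for_each 2 write_entry) (length A * (2 + 4) + 4)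
      (?S 0) ((?S (length A))(2 := tape_of A))"
  proof (rule runs_for_each)
    fix j
    assume "j < length A"
    from runs_write_entry[OF assms(1) this assms(2,3), of "out @ map (arc_bit n A p) [0..<j]" u]
    show "runs 7 write_entry 2 (?S j) ((?S (Suc j))(2 := tape_at A (int j)))"
      by (simp add: arc_tapes_update)
  qed (simp_all add: arc_tapes_apply)
  then show ?thesis
    by (simp add: arc_tapes_update row_bits_def mult.commute)
qed

lemma runs_write_row:
  fixes p n v :: nat
  assumes "p < length A" "p mod n = v" "0 < n"
  shows "runs 7 write_row (11 * length A + 5 * n + 13) (arc_tapes n A out p 0 u v (- int (v * n)))
    (arc_tapes n A (out @ row_bits n A p) (Suc p) 0 u v (- int (Suc v * n)))"
proof -
  let ?out = "out @ row_bits n A p" and ?m = "int (length A)" and ?z = "- int (v * n)"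
  have "runs 7 (for_each 2 write_entry) (6 * length A + 4) (arc_tapes n A out p 0 u v ?z)
      (arc_tapes n A ?out p 0 u v (?m - int (v * n)))"
    using assms by (rule runs_write_entries)
  also have "runs 7 (for_each 2 (move 5 Left)) (length A * 5 + 4) \<dots>
      (arc_tapes n A ?out p 0 u v (?m - int (v * n) + ?m * offset Left))"
    by (rule runs_move_window)
  also have "\<dots> = arc_tapes n A ?out p 0 u v ?z"
    by simp
  also have "runs 7 (for_each 6 (move 5 Left)) (n * 5 + 4) \<dots>
      (arc_tapes n A ?out p 0 u v (?z + int n * offset Left))"
    by (rule runs_move_window)
  also have "runs 7 (move 1 Right) 1 \<dots> (\<dots>(1 := tape_at A (int p + offset Right)))"
    by (rule runs_move) (simp_all add: arc_tapes_apply)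
  also have "\<dots> = arc_tapes n A ?out (Suc p) 0 u v (- int (Suc v * n))"
    by (simp add: arc_tapes_update algebra_simps)
  finally show ?thesis
    unfolding write_row_def by (rule runs_mono) simp
qed

lemma runs_write_block:
  fixes n u :: nat
  assumes "length A = n * n" "u < n"
  shows "runs 7 write_block (n * (11 * length A + 5 * n + 17) + 5 * length A + 8)
    (arc_tapes n A (out @ rows_bits n A (u * n)) (int (u * n)) 0 s 0 0)
    (arc_tapes n A (out @ rows_bits n A (Suc u * n)) (int (Suc u * n)) 0 s 0 0)"
proof -
  let ?rows = "\<lambda>p. out @ rows_bits n A p"
  let ?S = "\<lambda>v. arc_tapes n A (?rows (u * n + v)) (int (u * n + v)) 0 s (int v) (- int (v * n))"
  have "runs 7 (for_each 4 write_row)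
      (length (replicate n True) * (11 * length A + 5 * n + 13 + 4) + 4)
      (?S 0) ((?S (length (replicate n True)))(4 := tape_of (replicate n True)))"
  proof (rule runs_for_each)
    fix v
    assume "v < length (replicate n True)"
    then have v: "v < n"
      by simp
    have "u * n + v < Suc u * n"
      using v by simp
    also have "\<dots> \<le> length A"
      unfolding assms(1) using assms(2) by (intro mult_le_mono1) simp
    finally have "runs 7 write_row (11 * length A + 5 * n + 13) (?S v)
        (arc_tapes n A (?rows (u * n + v) @ row_bits n A (u * n + v)) (Suc (u * n + v)) 0 s (int v)
          (- int (Suc v * n)))"
      using v by (intro runs_write_row) auto
    then show "runs 7 write_row (11 * length A + 5 * n + 13) (?S v)
        ((?S (Suc v))(4 := tape_at (replicate n True) (int v)))"
      by (simp add: arc_tapes_update)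
  qed (simp_all add: arc_tapes_apply)
  also have "\<dots> = arc_tapes n A (?rows (Suc u * n)) (int (Suc u * n)) 0 s 0 (- int (length A))"
    by (simp add: arc_tapes_update assms(1) add.commute)
  also have "runs 7 (for_each 2 (move 5 Right)) (length A * 5 + 4) \<dots>
      (arc_tapes n A (?rows (Suc u * n)) (int (Suc u * n)) 0 s 0
        (- int (length A) + int (length A) * offset Right))"
    by (rule runs_move_window)
  finally show ?thesis
    unfolding write_block_def by (simp add: algebra_simps)
qed

lemma runs_write_blocks:
  assumes "length A = n * n"
  shows "runs 7 (for_each 3 write_block)
    (n * (n * (11 * length A + 5 * n + 17) + 5 * length A + 12) + 4)
    (arc_tapes n A out 0 0 0 0 0)
    (arc_tapes n A (out @ rows_bits n A (length A)) (int (length A)) 0 0 0 0)"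
proof -
  let ?S = "\<lambda>u. arc_tapes n A (out @ rows_bits n A (u * n))
    (int (u * n)) 0 (int u) 0 0"
  have "runs 7 (for_each 3 write_block)
      (length (replicate n True) * (n * (11 * length A + 5 * n + 17) + 5 * length A + 8 + 4) + 4)
      (?S 0) ((?S (length (replicate n True)))(3 := tape_of (replicate n True)))"
  proof (rule runs_for_each)
    fix u
    assume "u < length (replicate n True)"
    then have "u < n"
      by simp
    from runs_write_block[OF assms this]
    show "runs 7 write_block (n * (11 * length A + 5 * n + 17) + 5 * length A + 8) (?S u)
        ((?S (Suc u))(3 := tape_at (replicate n True) (int u)))"
      by (simp only: arc_tapes_update)
  qed (simp_all add: arc_tapes_apply)
  then show ?thesis
    by (simp add: arc_tapes_update assms add.assoc)
qed

lemma length_arc_word: "length A = n * n \<Longrightarrow> length (arc_word n A) = n * n + 1 + n * n * (n * n)"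
  by (simp add: arc_word_def row_bits_def length_concat comp_def sum_list_triv)

lemma arc_prog_time_le:
  fixes n m l :: nat
  assumes "n \<le> l" "m \<le> l"
  shows "26 * n + 12 * m + 37 + (5 * m + 5) + (n * (n * (11 * m + 5 * n + 17) + 5 * m + 12) + 4) +
    (2 * (m + 1 + m * m) + 3) \<le> poly arc_prog_bound l" (is "?time \<le> _")
proof -
  have "?time \<le> 26 * l + 12 * l + 37 + (5 * l + 5) +
      (l * (l * (11 * l + 5 * l + 17) + 5 * l + 12) + 4) + (2 * (l + 1 + l * l) + 3)"
    using assms by (intro add_mono mult_le_mono order_refl)
  also have "\<dots> = poly arc_prog_bound l"
    by (simp add: arc_prog_bound_def algebra_simps)
  finally show ?thesis .
qed

lemma runs_arc_prog:
  assumes "length A = n * n"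
  defines "x \<equiv> replicate n True @ False # A"
  obtains Ts where
    "runs 7 arc_prog (poly arc_prog_bound (length x)) (input_tapes x) Ts"
    "Ts 0 = tape_of (arc_word n A)"
proof
  let ?m = "length A" and ?w = "arc_word n A"
  let ?end = "arc_tapes n A ?w (int ?m) 0 0 0 0"
  have arc_word: "?w = (replicate ?m True @ [False]) @ rows_bits n A ?m"
    by (simp add: arc_word_def assms(1))
  have "runs 7 read_input (26 * n + 12 * ?m + 37) (input_tapes x)
      (arc_tapes n A [] 0 0 0 0 0)"
    unfolding x_def by (rule runs_read_input)
  also have "runs 7 write_header (5 * ?m + 5) \<dots>
      (arc_tapes n A (replicate ?m True @ [False]) 0 0 0 0 0)"
    by (rule runs_write_header)
  also have "runs 7 (for_each 3 write_block)
      (n * (n * (11 * ?m + 5 * n + 17) + 5 * ?m + 12) + 4) \<dots> ?end"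
    unfolding arc_word using assms(1) by (rule runs_write_blocks)
  also have "runs 7 (rewind 0) (2 * length ?w + 3) \<dots> (\<dots>(0 := tape_of ?w))"
    by (rule runs_rewind) (simp_all add: arc_tapes_apply)
  finally show "runs 7 arc_prog (poly arc_prog_bound (length x))
      (input_tapes x) (?end(0 := tape_of ?w))"
    unfolding arc_prog_def
  proof (rule runs_mono)
    have "length ?w = ?m + 1 + ?m * ?m"
      using length_arc_word assms(1) by simp
    then show "26 * n + 12 * ?m + 37 + (5 * ?m + 5) +
        (n * (n * (11 * ?m + 5 * n + 17) + 5 * ?m + 12) + 4) + (2 * length ?w + 3)
      \<le> poly arc_prog_bound (length x)"
      using arc_prog_time_le[of n "length x" ?m] by (simp only: x_def) simp
  qed
  show "(?end(0 := tape_of ?w)) 0 = tape_of ?w"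
    by simp
qed

section \<open>The reduction\<close>

definition adjacency_bits :: "nat pair_pre_digraph \<Rightarrow> bool list" where
  "adjacency_bits I = (let n = card (pverts I) in
     map (\<lambda>p. (p div n, p mod n) \<in> parcs I) [0..<n * n])"

lemma concat_map_upt:
  fixes n :: nat
  shows "concat (map (\<lambda>u. map (f u) [0..<n]) [0..<k]) = map (\<lambda>p. f (p div n) (p mod n)) [0..<k * n]"
proof (induction k)
  case (Suc k)
  have "map (f k) [0..<n] = map (\<lambda>p. f (p div n) (p mod n)) [k * n..<k * n + n]"
    by (rule nth_equalityI) (simp_all add: add.commute)
  moreover have "[0..<Suc k * n] = [0..<k * n] @ [k * n..<k * n + n]"
    by (metis add.commute le0 mult_Suc upt_add_eq_append)
  ultimately show ?case
    using Suc by (simp del: mult_Suc)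
qed simp

lemma encode_eq_adjacency_bits:
  "encode I = replicate (card (pverts I)) True @ False # adjacency_bits I"
  unfolding encode_def adjacency_bits_def Let_def concat_map_upt[where f = "\<lambda>u v. (u, v) \<in> parcs I"]
  by simp

lemma encode_arc_instance:
  "encode (arc_instance I) = arc_word (card (pverts I)) (adjacency_bits I)"
proof -
  define n where "n = card (pverts I)"
  have "row_bits n (adjacency_bits I) p = map (\<lambda>q. (p, q) \<in> parcs (arc_instance I)) [0..<n * n]"
    if "p < n * n" for p
    using that
    by (auto simp: row_bits_def arc_bit_def adjacency_bits_def arc_instance_def arc_digraph_def
        Let_def simp flip: n_def)
  then have "map (row_bits n (adjacency_bits I)) [0..<n * n]
    = map (\<lambda>p. map (\<lambda>q. (p, q) \<in> parcs (arc_instance I)) [0..<n * n]) [0..<n * n]"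
    by simp
  then show ?thesis
    by (simp only: encode_def Let_def pverts_arc_instance card_lessThan arc_word_def append_Cons
        append_Nil flip: n_def)
qed

lemma polytime_converts_arc_instance: "polytime_converts A encode (encode \<circ> arc_instance)"
proof -
  have "outputs_within (prog_tm 7 arc_prog) [encode I]
      (poly arc_prog_bound (length (encode I))) (encode (arc_instance I))" for I
  proof -
    have "length (adjacency_bits I) = card (pverts I) * card (pverts I)"
      by (simp add: adjacency_bits_def Let_def)
    from runs_arc_prog[OF this] obtain Ts where
      "runs 7 arc_prog (poly arc_prog_bound (length (encode I)))
         (input_tapes (encode I)) Ts" "Ts 0 = tape_of (encode (arc_instance I))"
      unfolding encode_arc_instance encode_eq_adjacency_bits[of I] by blast
    then show ?thesis
      by (rule outputs_within_prog_tm) simp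
  qed
  moreover have "is_tm (prog_tm 7 arc_prog)"
    by (rule is_tm_prog_tm) simp
  ultimately show ?thesis
    unfolding polytime_converts_def comp_apply by blast
qed

theorem theorem4p17:
  fixes H :: "'h pair_pre_digraph"
  assumes "pair_digraph H"
    and "\<And>G :: nat pair_pre_digraph. pair_digraph G \<Longrightarrow> H \<rightarrow>\<^sub>h G \<Longrightarrow> NP_hard (PCSP H G)"
  shows "\<forall>G :: 'g pair_pre_digraph. pair_digraph G \<longrightarrow> K3 \<rightarrow>\<^sub>h G \<longrightarrow> NP_hard (PCSP K3 G)"
proof (intro allI impI)
  fix G :: "'g pair_pre_digraph"
  assume G: "pair_digraph G"
  define i where "i = 2 * card (pverts H)"
  define k :: nat where "k = max (card (pverts H)) (((^) 2 ^^ i) (card (pverts G)))"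
  show "NP_hard (PCSP K3 G)"
  proof (rule NP_hard_PCSP_transfer)
    show "NP_hard (PCSP H (complete_on {..<k}))"
      using assms by (simp add: pair_digraph_complete_on pair_digraph_hom_to_complete_on k_def)
    show "polytime_converts (Collect instance_digraph) encode (encode \<circ> (arc_instance ^^ i))"
      by (intro polytime_converts_funpow polytime_converts_arc_instance)
        (auto intro: instance_digraph_arc_instance)
    show "instance_digraph ((arc_instance ^^ i) I)" if "instance_digraph I" for I
      using that by (rule instance_digraph_arc_instance_funpow)
    show "(arc_instance ^^ i) I \<rightarrow>\<^sub>h K3" if "I \<rightarrow>\<^sub>h H" for I
      using assms(1) that unfolding i_def by (rule arc_instance_funpow_hom_to_K3)
    show "I \<rightarrow>\<^sub>h complete_on {..<k}" if "instance_digraph I" "(arc_instance ^^ i) I \<rightarrow>\<^sub>h G" for I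
      using G that by (rule hom_to_complete_on_if_arc_instance_funpow_hom_to) (simp add: k_def)
  qed
qed

end
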